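(* Let $\Bbbk$ be an algebraically closed field with $\mathrm{char}(\Bbbk)\neq 2$. Let $A=\Bbbk[x,y,t]$ be an $\mathbb N$-graded Poisson algebra (standard grading) with $t$ Poisson central and $\{x,y\}=f\in A_2$. Then, up to a change of variables, the possibilities for $f$ are: (1) $f=0$; (2) $f=t^2$; (3) $f=xt$; (4a) $f=x^2$; (4b) $f=x^2+t^2$; (4c) $f=x^2+yt$; (5a) $f=\lambda xy$ with $\lambda\in\Bbbk^\times$; (5b) $f=\lambda xy+t^2$ with $\lambda\in\Bbbk^\times$. Moreover, the Poisson algebras determined by the $f$ listed above are pairwise non-isomorphic as Poisson algebras, with the exception of replacing $\lambda$ by $-\lambda$ in (5a) and in (5b).
   Context: A Poisson algebra is a commutative $\Bbbk$-algebra with a $\Bbbk$-bilinear bracket $\{-,-\}$ that is a Lie bracket and a biderivation. The grading on $\Bbbk[x,y,t]$ is the standard one with $\deg x=\deg y=\deg t=1$, and $A_2$ is the space of homogeneous quadratic polynomials. An element $t$ is Poisson central if $\{t,a\}=0$ for all $a\in A$. "Up to a change of variables" means up to replacing $x,y,t$ by another system of polynomial generators, so that $A$ is isomorphic as a Poisson algebra to $\Bbbk[x,y,t]$ with $t$ Poisson central and $\{x,y\}$ equal to one of the listed polynomials. Isomorphisms of Poisson algebras are $\Bbbk$-algebra isomorphisms preserving the bracket. *)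

theory Defs
  imports "HOL-Library.Poly_Mapping" "HOL-Computational_Algebra.Polynomial"
begin

section \<open>Poisson algebras\<close>

locale poisson_algebra = vector_space scale
  for scale :: "'k::field \<Rightarrow> 'a::comm_ring_1 \<Rightarrow> 'a" +
  fixes bracket :: "'a \<Rightarrow> 'a \<Rightarrow> 'a"
  assumes scale_mult: "scale r (a * b) = scale r a * b"
    and linear_left: "Vector_Spaces.linear scale scale (\<lambda>a. bracket a b)"
    and linear_right: "Vector_Spaces.linear scale scale (\<lambda>b. bracket a b)"
    and alternating: "bracket a a = 0"
    and jacobi: "bracket a (bracket b c) + bracket b (bracket c a) + bracket c (bracket a b) = 0"
    and derivation_left: "bracket (a * b) c = a * bracket b c + bracket a c * b"
    and derivation_right: "bracket a (b * c) = b * bracket a c + bracket a b * c"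

definition poisson_iso ::
  "('k::field \<Rightarrow> 'a::comm_ring_1 \<Rightarrow> 'a) \<Rightarrow> ('a \<Rightarrow> 'a \<Rightarrow> 'a) \<Rightarrow>
   ('k \<Rightarrow> 'b::comm_ring_1 \<Rightarrow> 'b) \<Rightarrow> ('b \<Rightarrow> 'b \<Rightarrow> 'b) \<Rightarrow> ('a \<Rightarrow> 'b) \<Rightarrow> bool" where
  "poisson_iso scaleA brA scaleB brB \<phi> \<longleftrightarrow>
     bij \<phi> \<and> Vector_Spaces.linear scaleA scaleB \<phi> \<and>
     \<phi> 1 = 1 \<and> (\<forall>a b. \<phi> (a * b) = \<phi> a * \<phi> b) \<and>
     (\<forall>a b. \<phi> (brA a b) = brB (\<phi> a) (\<phi> b))"

section \<open>The polynomial ring in three variables\<close>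

datatype indet = Ix | Iy | It

text \<open>
  Exponent vectors are finitely supported maps from indeterminates to natural numbers, and
  polynomials are finitely supported maps from exponent vectors to coefficients; the library
  product on these types is convolution, i.e. the usual product of polynomials.
\<close>
type_synonym 'k poly3 = "(indet \<Rightarrow>\<^sub>0 nat) \<Rightarrow>\<^sub>0 'k"

definition const :: "'k::comm_ring_1 \<Rightarrow> 'k poly3" where
  "const c = Poly_Mapping.single 0 c"

definition smul :: "'k::comm_ring_1 \<Rightarrow> 'k poly3 \<Rightarrow> 'k poly3" where
  "smul c p = const c * p"

definition var :: "indet \<Rightarrow> 'k::comm_ring_1 poly3" where
  "var i = Poly_Mapping.single (Poly_Mapping.single i 1) 1"

abbreviation X :: "'k::comm_ring_1 poly3" where "X \<equiv> var Ix"
abbreviation Y :: "'k::comm_ring_1 poly3" where "Y \<equiv> var Iy"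
abbreviation T :: "'k::comm_ring_1 poly3" where "T \<equiv> var It"

definition monom_degree :: "(indet \<Rightarrow>\<^sub>0 nat) \<Rightarrow> nat" where
  "monom_degree m = Poly_Mapping.lookup m Ix + Poly_Mapping.lookup m Iy + Poly_Mapping.lookup m It"

definition homogeneous :: "nat \<Rightarrow> 'k::comm_ring_1 poly3 set" where
  "homogeneous n = {p. \<forall>m \<in> Poly_Mapping.keys p. monom_degree m = n}"

section \<open>Poisson brackets on the polynomial ring\<close>

definition graded_bracket :: "('k::comm_ring_1 poly3 \<Rightarrow> 'k poly3 \<Rightarrow> 'k poly3) \<Rightarrow> bool" where
  "graded_bracket br \<longleftrightarrow>
     (\<forall>i j. \<forall>p \<in> homogeneous i. \<forall>q \<in> homogeneous j. br p q \<in> homogeneous (i + j))"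

definition determined_by ::
  "('k::field poly3 \<Rightarrow> 'k poly3 \<Rightarrow> 'k poly3) \<Rightarrow> 'k poly3 \<Rightarrow> bool" where
  "determined_by br f \<longleftrightarrow> poisson_algebra smul br \<and> (\<forall>a. br T a = 0) \<and> br X Y = f"

definition poisson_isomorphic ::
  "('k::field poly3 \<Rightarrow> 'k poly3 \<Rightarrow> 'k poly3) \<Rightarrow> ('k poly3 \<Rightarrow> 'k poly3 \<Rightarrow> 'k poly3) \<Rightarrow> bool" where
  "poisson_isomorphic br br' \<longleftrightarrow> (\<exists>\<phi>. poisson_iso smul br smul br' \<phi>)"

definition normal_forms :: "'k::field poly3 set" where
  "normal_forms =
     {0, T\<^sup>2, X * T, X\<^sup>2, X\<^sup>2 + T\<^sup>2, X\<^sup>2 + Y * T} \<union>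
     {smul lam (X * Y) | lam. lam \<noteq> 0} \<union>
     {smul lam (X * Y) + T\<^sup>2 | lam. lam \<noteq> 0}"

end

theory Submission
  imports Defs
begin

text \<open>
  If \<open>T\<close> is central, then the biderivation property leaves no freedom beyond \<open>f = {X, Y}\<close>: the
  bracket is \<open>{p, q} = f (p\<^sub>x q\<^sub>y - p\<^sub>y q\<^sub>x)\<close>, and for every \<open>f\<close> this formula is a Poisson bracket
  (lemmas \<open>determined_by_unique\<close> and \<open>determined_by_planar_bracket\<close>). So the theorem is about
  ternary quadratic forms \<open>f\<close>, and the question is which equivalence relation on them isomorphism
  of Poisson algebras induces.

  The answer is \<^emph>\<open>linear equivalence\<close>. A substitution \<open>X \<mapsto> u\<close>, \<open>Y \<mapsto> v\<close>, \<open>T \<mapsto> d T\<close> with linear forms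
  \<open>u\<close>, \<open>v\<close> multiplies the Jacobian \<open>p\<^sub>x q\<^sub>y - p\<^sub>y q\<^sub>x\<close> by the determinant \<open>\<delta>\<close> of the \<open>X\<close>- and \<open>Y\<close>-coefficients of
  \<open>u\<close> and \<open>v\<close>; hence it is an isomorphism from the algebra of \<open>f\<close> to the algebra of \<open>g\<close> as soon as
  \<open>f(u, v, d T) = \<delta> g\<close>. The converse is the heart of the proof
  (\<open>isomorphic_imp_linearly_equivalent\<close>). An isomorphism \<open>\<phi>\<close> need not be graded and need not send
  \<open>T\<close> to a polynomial in \<open>T\<close>: in characteristic \<open>p\<close> the map fixing \<open>X\<close> and \<open>Y\<close> with \<open>T \<mapsto> T + X\<^sup>p\<close>
  is an automorphism for \<open>f = X\<^sup>2\<close>. But it can be replaced by its differential \<open>L\<close> at the origin.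
  Applying \<open>\<phi>\<close> to \<open>{X, Y} = f\<close> gives \<open>\<phi> f = g J\<close>, where \<open>J\<close> is the Jacobian of \<open>\<phi> X\<close> and
  \<open>\<phi> Y\<close>. The right-hand side vanishes to second order at the origin, so the point
  to which the origin is sent is a critical point of \<open>f\<close>, and the second-order terms at the origin
  involve only \<open>L\<close> and the Hessian of \<open>f\<close>, which is constant. Comparing them yields
  \<open>f \<circ> L = J(0) g\<close>; here the characteristic must not be 2, for a quadratic form to be recoverable
  from its Hessian. Centrality of \<open>\<phi> T\<close> forces \<open>L T = d T\<close>, and surjectivity of \<open>\<phi>\<close> makes \<open>L\<close>
  injective, so that \<open>d\<close> and \<open>J(0)\<close> do not vanish.

  What remains is algebra with six coefficients in the field. Every quadratic form is reached from
  a normal form by factoring its part without \<open>T\<close> and completing squares or products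
  (\<open>linearly_equivalent_to_normal_form\<close>). The normal forms are told apart by the discriminant of
  that binary part, which is an honest invariant and gives \<open>\<lambda>\<^sup>2\<close> on the last two families, and by
  a few polynomial identities that survive linear equivalence
  (\<open>linearly_equivalent_normal_forms\<close>).
\<close>

section \<open>Derivatives and substitutions\<close>

lemma sum_of_monomials:
  fixes p :: "'a \<Rightarrow>\<^sub>0 'b::comm_monoid_add"
  shows "(\<Sum>m\<in>Poly_Mapping.keys p. Poly_Mapping.single m (Poly_Mapping.lookup p m)) = p"
  by (rule poly_mapping_eqI) (auto simp: lookup_sum lookup_single when_def in_keys_iff)

lemma poly_mapping_induct_single [case_names single add]:
  fixes p :: "'a \<Rightarrow>\<^sub>0 'b::comm_monoid_add"
  assumes single: "\<And>m c. P (Poly_Mapping.single m c)"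
    and add: "\<And>p q. P p \<Longrightarrow> P q \<Longrightarrow> P (p + q)"
  shows "P p"
proof -
  have "P (\<Sum>m\<in>M. Poly_Mapping.single m (Poly_Mapping.lookup p m))" if "finite M" for M
    using that
  proof induction
    case empty
    show ?case using single[of undefined 0] by simp
  qed (auto intro: single add)
  then show ?thesis by (metis finite_keys sum_of_monomials)
qed

definition evaluate_monom :: "'a::comm_ring_1 \<Rightarrow> 'a \<Rightarrow> 'a \<Rightarrow> (indet \<Rightarrow>\<^sub>0 nat) \<Rightarrow> 'a" where
  "evaluate_monom u v w m =
     u ^ Poly_Mapping.lookup m Ix * v ^ Poly_Mapping.lookup m Iy * w ^ Poly_Mapping.lookup m It"

lemma evaluate_monom_add:
  "evaluate_monom u v w (m + n) = evaluate_monom u v w m * evaluate_monom u v w n"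
  by (simp add: evaluate_monom_def lookup_add power_add)

definition substitute :: "'k::comm_ring_1 poly3 \<Rightarrow> 'k poly3 \<Rightarrow> 'k poly3 \<Rightarrow> 'k poly3 \<Rightarrow> 'k poly3" where
  "substitute u v w p =
     (\<Sum>m\<in>Poly_Mapping.keys p. const (Poly_Mapping.lookup p m) * evaluate_monom u v w m)"

text \<open>
  The formal partial derivative. Subtraction of exponents is truncated, which is harmless because
  the coefficient is then multiplied by \<open>0\<close>.
\<close>

definition pderiv3 :: "indet \<Rightarrow> 'k::comm_ring_1 poly3 \<Rightarrow> 'k poly3" where
  "pderiv3 i p = (\<Sum>m\<in>Poly_Mapping.keys p.
     Poly_Mapping.single (m - Poly_Mapping.single i 1)
       (of_nat (Poly_Mapping.lookup m i) * Poly_Mapping.lookup p m))"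

definition at_origin :: "'k::comm_ring_1 poly3 \<Rightarrow> 'k" where
  "at_origin p = Poly_Mapping.lookup p 0"

lemma const_mult [simp]: "const (a * b) = const a * const b"
  by (simp add: const_def mult_single)

lemma const_simps [simp]:
  "const 0 = 0" "const 1 = 1" "const (a + b) = const a + const b"
  "const (- a) = - const a" "const (a - b) = const a - const b" "const (numeral k) = numeral k"
  by (simp_all add: const_def single_add single_uminus single_diff)

lemma var_power: "var i ^ n = Poly_Mapping.single (Poly_Mapping.single i n) 1"
  by (induction n) (simp_all add: var_def mult_single flip: single_add)

lemma monomial_as_product:
  "Poly_Mapping.single m c =
     const c * (X ^ Poly_Mapping.lookup m Ix * Y ^ Poly_Mapping.lookup m Iy * T ^ Poly_Mapping.lookup m It)"
proof -
  have "Poly_Mapping.single Ix (Poly_Mapping.lookup m Ix) +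
      Poly_Mapping.single Iy (Poly_Mapping.lookup m Iy) +
      Poly_Mapping.single It (Poly_Mapping.lookup m It) = m"
    (is "?m = m")
  proof (rule poly_mapping_eqI)
    fix i show "Poly_Mapping.lookup ?m i = Poly_Mapping.lookup m i"
      by (cases i) (simp_all add: lookup_add lookup_single)
  qed
  then show ?thesis by (simp add: var_power const_def mult_single)
qed

text \<open>
  Constants and variables generate the polynomial ring. Identities between derivations or
  homomorphisms are proved by this induction, while those that merely are bilinear
  reduce to monomials by \<open>poly_mapping_induct_single\<close>.
\<close>

lemma poly3_induct [case_names const var add mult]:
  fixes p :: "'k::comm_ring_1 poly3"
  assumes const: "\<And>c. P (const c)" and var: "\<And>i. P (var i)"
    and add: "\<And>p q. P p \<Longrightarrow> P q \<Longrightarrow> P (p + q)"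
    and mult: "\<And>p q. P p \<Longrightarrow> P q \<Longrightarrow> P (p * q)"
  shows "P p"
proof (induction p rule: poly_mapping_induct_single)
  case (single m c)
  have "P (var i ^ n)" for i n
    by (induction n) (use const[of 1] in \<open>auto intro: var mult\<close>)
  then show ?case
    unfolding monomial_as_product by (intro mult const)
qed (rule add)

lemma pderiv3_add [simp]: "pderiv3 i (p + q) = pderiv3 i p + pderiv3 i q"
  unfolding pderiv3_def by (rule setsum_keys_plus_distrib) (simp_all add: algebra_simps single_add)

lemma pderiv3_single:
  "pderiv3 i (Poly_Mapping.single m c) =
     Poly_Mapping.single (m - Poly_Mapping.single i 1) (of_nat (Poly_Mapping.lookup m i) * c)"
  by (simp add: pderiv3_def)

lemma pderiv3_mult [simp]: "pderiv3 i (p * q) = p * pderiv3 i q + pderiv3 i p * q"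
proof (induction p rule: poly_mapping_induct_single)
  case (single m c)
  show ?case
  proof (induction q rule: poly_mapping_induct_single)
    case (single n d)
    have shift: "Poly_Mapping.single (a + (b - Poly_Mapping.single i 1)) (of_nat (Poly_Mapping.lookup b i) * e)
        = Poly_Mapping.single (a + b - Poly_Mapping.single i 1) (of_nat (Poly_Mapping.lookup b i) * e)"
      for a b and e :: 'a
    proof (cases "Poly_Mapping.lookup b i = 0")
      case False
      have "a + (b - Poly_Mapping.single i 1) = a + b - Poly_Mapping.single i 1"
        using False by (intro poly_mapping_eqI) (auto simp: lookup_add lookup_minus lookup_single when_def)
      then show ?thesis by simp
    qed simp
    show ?case
      using shift[of m n "c * d"] shift[of n m "c * d"]
      by (simp add: pderiv3_single mult_single lookup_add algebra_simps flip: single_add)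
  qed (simp_all add: algebra_simps)
qed (simp_all add: algebra_simps)

lemma pderiv3_const [simp]: "pderiv3 i (const c) = 0"
  by (simp add: const_def pderiv3_single)

lemma pderiv3_var [simp]: "pderiv3 i (var j) = (if i = j then 1 else 0)"
  by (simp add: var_def pderiv3_single lookup_single when_def)

lemma pderiv3_0 [simp]: "pderiv3 i 0 = 0" and pderiv3_1 [simp]: "pderiv3 i 1 = 0"
  using pderiv3_const[of i 0] pderiv3_const[of i 1] by simp_all

lemma pderiv3_minus [simp]: "pderiv3 i (- p) = - pderiv3 i p"
  using pderiv3_add[of i p "- p"] by (simp add: eq_neg_iff_add_eq_0 add.commute)

lemma pderiv3_diff [simp]: "pderiv3 i (p - q) = pderiv3 i p - pderiv3 i q"
  using pderiv3_add[of i p "- q"] by simp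

lemma pderiv3_commute: "pderiv3 i (pderiv3 j p) = pderiv3 j (pderiv3 i p)"
  by (induction p rule: poly3_induct) (simp_all add: algebra_simps)

lemma at_origin_add [simp]: "at_origin (p + q) = at_origin p + at_origin q"
  and at_origin_diff [simp]: "at_origin (p - q) = at_origin p - at_origin q"
  and at_origin_const [simp]: "at_origin (const c) = c"
  and at_origin_var [simp]: "at_origin (var i) = 0"
  and at_origin_0 [simp]: "at_origin 0 = 0"
  and at_origin_1 [simp]: "at_origin 1 = 1"
proof -
  have "Poly_Mapping.single i (1::nat) \<noteq> 0"
    by (metis lookup_single_eq lookup_zero one_neq_zero)
  then show "at_origin (var i) = 0"
    by (simp add: at_origin_def var_def lookup_single)
qed (simp_all add: at_origin_def lookup_add lookup_minus const_def)

lemma at_origin_mult [simp]: "at_origin (p * q) = at_origin p * at_origin q"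
proof (induction p rule: poly_mapping_induct_single)
  case (single m c)
  show ?case
  proof (induction q rule: poly_mapping_induct_single)
    case (single n d)
    have "m + n = 0 \<longleftrightarrow> m = 0 \<and> n = 0"
      by (auto simp: poly_mapping_eq_iff lookup_add fun_eq_iff)
    then show ?case
      by (auto simp: at_origin_def mult_single lookup_single when_def)
  qed (simp_all add: algebra_simps)
qed (simp_all add: algebra_simps)

locale algebra_endo =
  fixes \<phi> :: "'k::comm_ring_1 poly3 \<Rightarrow> 'k poly3"
  assumes add [simp]: "\<phi> (p + q) = \<phi> p + \<phi> q"
    and mult [simp]: "\<phi> (p * q) = \<phi> p * \<phi> q"
    and const [simp]: "\<phi> (const c) = const c"
begin

lemma zero [simp]: "\<phi> 0 = 0" and one [simp]: "\<phi> 1 = 1"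
  using const[of 0] const[of 1] by simp_all

lemma minus [simp]: "\<phi> (- p) = - \<phi> p"
  using add[of p "- p"] by (simp add: eq_neg_iff_add_eq_0 add.commute)

lemma diff [simp]: "\<phi> (p - q) = \<phi> p - \<phi> q"
  using add[of p "- q"] by simp

lemma smul [simp]: "\<phi> (smul c p) = smul c (\<phi> p)"
  by (simp add: smul_def)

lemma power [simp]: "\<phi> (p ^ n) = \<phi> p ^ n"
  by (induction n) simp_all

text \<open>
  A derivation twisted by \<open>\<phi>\<close> is determined by its values on the variables, and the right-hand
  side is such a derivation with the same values.
  With \<open>\<phi>\<close> the identity this computes Poisson brackets, with \<open>D = \<partial>\<^sub>i \<circ> \<phi>\<close> it is the chain rule.
\<close>

lemma derivation_along:
  assumes D_add: "\<And>p q. D (p + q) = D p + D q"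
    and D_mult: "\<And>p q. D (p * q) = \<phi> p * D q + D p * \<phi> q"
    and D_const: "\<And>c. D (const c) = 0"
  shows "D p = \<phi> (pderiv3 Ix p) * D X + \<phi> (pderiv3 Iy p) * D Y + \<phi> (pderiv3 It p) * D T"
proof (induction p rule: poly3_induct)
  case (var i)
  show ?case by (cases i) simp_all
qed (simp_all add: D_const D_add D_mult algebra_simps)

lemma chain_rule:
  "pderiv3 i (\<phi> p) = \<phi> (pderiv3 Ix p) * pderiv3 i (\<phi> X) + \<phi> (pderiv3 Iy p) * pderiv3 i (\<phi> Y)
     + \<phi> (pderiv3 It p) * pderiv3 i (\<phi> T)"
  by (rule derivation_along) simp_all

end

lemma algebra_endo_eqI:
  assumes "algebra_endo \<phi>" "algebra_endo \<psi>" and "\<And>i. \<phi> (var i) = \<psi> (var i)"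
  shows "\<phi> p = \<psi> p"
proof -
  interpret \<phi>: algebra_endo \<phi> by fact
  interpret \<psi>: algebra_endo \<psi> by fact
  show ?thesis
    by (induction p rule: poly3_induct) (simp_all add: assms(3))
qed

lemma substitute_single:
  "substitute u v w (Poly_Mapping.single m c) = const c * evaluate_monom u v w m"
  by (simp add: substitute_def)

lemma substitute_add: "substitute u v w (p + q) = substitute u v w p + substitute u v w q"
  unfolding substitute_def by (rule setsum_keys_plus_distrib) (simp_all add: algebra_simps)

lemma algebra_endo_substitute: "algebra_endo (substitute u v w)"
proof
  fix p q c
  show add: "substitute u v w (p + q) = substitute u v w p + substitute u v w q" for p q
    by (rule substitute_add)
  show "substitute u v w (const c) = const c"
    unfolding const_def[of c] by (simp add: substitute_single const_def evaluate_monom_def)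
  show "substitute u v w (p * q) = substitute u v w p * substitute u v w q"
  proof (induction p rule: poly_mapping_induct_single)
    case (single m c)
    show ?case
    proof (induction q rule: poly_mapping_induct_single)
      case (single n d)
      show ?case
        by (simp add: substitute_single mult_single evaluate_monom_add algebra_simps)
    qed (simp_all add: add algebra_simps)
  qed (simp_all add: add algebra_simps)
qed

lemma substitute_var [simp]:
  "substitute u v w X = u" "substitute u v w Y = v" "substitute u v w T = w"
  by (simp_all add: var_def substitute_single evaluate_monom_def lookup_single)

section \<open>Poisson brackets for which T is central\<close>

definition jacobian_xy :: "'k::comm_ring_1 poly3 \<Rightarrow> 'k poly3 \<Rightarrow> 'k poly3" where
  "jacobian_xy p q = pderiv3 Ix p * pderiv3 Iy q - pderiv3 Iy p * pderiv3 Ix q"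

lemma jacobian_xy_jacobi:
  "jacobian_xy a (jacobian_xy b c) + jacobian_xy b (jacobian_xy c a)
     + jacobian_xy c (jacobian_xy a b) = 0"
  unfolding jacobian_xy_def by (simp add: pderiv3_commute[of Iy Ix] algebra_simps)

lemma jacobian_xy_mult: "jacobian_xy a (f * g) = f * jacobian_xy a g + jacobian_xy a f * g"
  unfolding jacobian_xy_def by (simp add: algebra_simps)

text \<open>
  The Pluecker relation between the \<open>2 \<times> 2\<close> minors formed by the gradients of \<open>a\<close>, \<open>b\<close>, \<open>c\<close>, \<open>f\<close>.
\<close>

lemma jacobian_xy_plucker:
  "jacobian_xy a f * jacobian_xy b c + jacobian_xy b f * jacobian_xy c a
     + jacobian_xy c f * jacobian_xy a b = 0"
  unfolding jacobian_xy_def by (simp add: algebra_simps)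

definition planar_bracket :: "'k::comm_ring_1 poly3 \<Rightarrow> 'k poly3 \<Rightarrow> 'k poly3 \<Rightarrow> 'k poly3" where
  "planar_bracket f p q = f * jacobian_xy p q"

text \<open>
  Multiplying the Jacobian bracket by a function keeps the Jacobi identity because only two
  variables are differentiated: the terms with derivatives of \<open>f\<close> cancel by the Pluecker relation.
\<close>

lemma planar_bracket_jacobi:
  "planar_bracket f a (planar_bracket f b c) + planar_bracket f b (planar_bracket f c a)
     + planar_bracket f c (planar_bracket f a b) = 0"
proof -
  have "planar_bracket f a (planar_bracket f b c) + planar_bracket f b (planar_bracket f c a)
     + planar_bracket f c (planar_bracket f a b) =
     f * f * (jacobian_xy a (jacobian_xy b c) + jacobian_xy b (jacobian_xy c a)
       + jacobian_xy c (jacobian_xy a b)) +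
     f * (jacobian_xy a f * jacobian_xy b c + jacobian_xy b f * jacobian_xy c a
       + jacobian_xy c f * jacobian_xy a b)"
    unfolding planar_bracket_def jacobian_xy_mult by (simp add: algebra_simps)
  then show ?thesis
    unfolding jacobian_xy_jacobi jacobian_xy_plucker by simp
qed

lemma pderiv3_smul [simp]: "pderiv3 i (smul c p) = smul c (pderiv3 i p)"
  by (simp add: smul_def)

lemma vector_space_smul: "vector_space (smul :: 'k::field \<Rightarrow> _)"
  by unfold_locales (simp_all add: smul_def algebra_simps)

lemma determined_by_planar_bracket:
  fixes f :: "'k::field poly3"
  shows "determined_by (planar_bracket f) f"
proof -
  interpret vector_space "smul :: 'k \<Rightarrow> _" by (rule vector_space_smul)
  have "poisson_algebra smul (planar_bracket f)"
  proof (intro poisson_algebra.intro poisson_algebra_axioms.intro)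
    show "Vector_Spaces.linear smul smul (\<lambda>a. planar_bracket f a b)"
      and "Vector_Spaces.linear smul smul (\<lambda>a. planar_bracket f b a)" for b
      by (simp_all add: Vector_Spaces.linear_iff vector_space_axioms planar_bracket_def jacobian_xy_def smul_def
          algebra_simps)
    show "vector_space (smul :: 'k \<Rightarrow> 'k poly3 \<Rightarrow> 'k poly3)"
      by (rule vector_space_smul)
    fix a b c :: "'k poly3"
    show "planar_bracket f a (planar_bracket f b c) + planar_bracket f b (planar_bracket f c a)
        + planar_bracket f c (planar_bracket f a b) = 0"
      by (rule planar_bracket_jacobi)
  qed (simp_all add: planar_bracket_def jacobian_xy_def smul_def algebra_simps)
  then show ?thesis
    by (simp add: determined_by_def planar_bracket_def jacobian_xy_def)
qed

text \<open>
  A biderivation is determined by its values on pairs of variables, and all of these except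
  \<open>{X, Y} = - {Y, X}\<close> vanish by centrality of \<open>T\<close> and by alternation.
\<close>

lemma determined_by_unique:
  fixes f :: "'k::field poly3"
  assumes "determined_by br f"
  shows "br = planar_bracket f"
proof (intro ext)
  interpret poisson_algebra smul br using assms by (simp add: determined_by_def)
  have id: "algebra_endo (\<lambda>p :: 'k poly3. p)" by unfold_locales simp_all
  have T: "br T a = 0" and XY: "br X Y = f" for a using assms by (auto simp: determined_by_def)
  have addl: "br (a + b) c = br a c + br b c" and addr: "br a (b + c) = br a b + br a c"
    and scl: "br (smul r a) b = smul r (br a b)" and scr: "br a (smul r b) = smul r (br a b)" for a b c r
    using linear_left linear_right by (simp_all add: Vector_Spaces.linear_iff)
  have anti: "br a b = - br b a" for a b
  proof -
    have "br (a + b) (a + b) = br a b + br b a"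
      unfolding addl addr by (simp add: alternating)
    then show ?thesis by (simp add: alternating eq_neg_iff_add_eq_0)
  qed
  have aT: "br a T = 0" and YX: "br Y X = - f" for a
    using anti[of a T] anti[of Y X] by (simp_all add: T XY)
  have "br 1 c = br 1 c + br 1 c" for c
    using derivation_left[of 1 1 c] by simp
  then have one: "br 1 c = 0" for c by (metis add_cancel_right_right)
  have constl: "br (const r) c = 0" for r c
    using scl[of r 1 c] by (simp add: smul_def one)
  have constr: "br c (const r) = 0" for r c
    using anti[of c "const r"] by (simp add: constl)
  fix p q
  have l: "br p q = pderiv3 Ix p * br X q + pderiv3 Iy p * br Y q + pderiv3 It p * br T q" for p q
    by (rule algebra_endo.derivation_along[OF id]) (simp_all add: addl derivation_left constl)
  have r: "br p q = pderiv3 Ix q * br p X + pderiv3 Iy q * br p Y + pderiv3 It q * br p T" for p q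
    by (rule algebra_endo.derivation_along[OF id]) (simp_all add: addr derivation_right constr)
  show "br p q = planar_bracket f p q"
    unfolding l[of p q] r[of X q] r[of Y q] T XY alternating aT YX planar_bracket_def jacobian_xy_def
    by (simp add: algebra_simps)
qed

section \<open>Linear changes of variables\<close>

definition linear_form :: "'k::comm_ring_1 \<Rightarrow> 'k \<Rightarrow> 'k \<Rightarrow> 'k poly3" where
  "linear_form a b c = smul a X + smul b Y + smul c T"

definition quadratic_form ::
  "'k::comm_ring_1 \<Rightarrow> 'k \<Rightarrow> 'k \<Rightarrow> 'k \<Rightarrow> 'k \<Rightarrow> 'k \<Rightarrow> 'k poly3" where
  "quadratic_form A B C D E F =
     smul A (X\<^sup>2) + smul B (X * Y) + smul C (Y\<^sup>2) + smul D (X * T) + smul E (Y * T) + smul F (T\<^sup>2)"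

lemma quadratic_form_add:
  "quadratic_form A B C D E F + quadratic_form A' B' C' D' E' F' =
     quadratic_form (A + A') (B + B') (C + C') (D + D') (E + E') (F + F')"
  by (simp add: quadratic_form_def smul_def algebra_simps)

lemma single_eq_quadratic_form:
  assumes "monom_degree m = 2"
  shows "\<exists>A B C D E F. Poly_Mapping.single m c = quadratic_form A B C D E F"
proof -
  define i j k where "i = Poly_Mapping.lookup m Ix" and "j = Poly_Mapping.lookup m Iy"
    and "k = Poly_Mapping.lookup m It"
  have m: "Poly_Mapping.single m c = const c * (X ^ i * Y ^ j * T ^ k)"
    unfolding i_def j_def k_def by (rule monomial_as_product)
  have "i + j + k = 2"
    using assms by (simp add: monom_degree_def i_def j_def k_def)
  then have "i = 2 \<and> j = 0 \<and> k = 0 \<or> i = 1 \<and> j = 1 \<and> k = 0 \<or> i = 0 \<and> j = 2 \<and> k = 0 \<or>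
      i = 1 \<and> j = 0 \<and> k = 1 \<or> i = 0 \<and> j = 1 \<and> k = 1 \<or> i = 0 \<and> j = 0 \<and> k = 2"
    by presburger
  then consider "i = 2" "j = 0" "k = 0" | "i = 1" "j = 1" "k = 0" | "i = 0" "j = 2" "k = 0"
    | "i = 1" "j = 0" "k = 1" | "i = 0" "j = 1" "k = 1" | "i = 0" "j = 0" "k = 2"
    by blast
  then show ?thesis
  proof cases
    case 1
    then have "Poly_Mapping.single m c = quadratic_form c 0 0 0 0 0"
      by (simp add: m quadratic_form_def smul_def)
    then show ?thesis by blast
  next
    case 2
    then have "Poly_Mapping.single m c = quadratic_form 0 c 0 0 0 0"
      by (simp add: m quadratic_form_def smul_def)
    then show ?thesis by blast
  next
    case 3
    then have "Poly_Mapping.single m c = quadratic_form 0 0 c 0 0 0"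
      by (simp add: m quadratic_form_def smul_def)
    then show ?thesis by blast
  next
    case 4
    then have "Poly_Mapping.single m c = quadratic_form 0 0 0 c 0 0"
      by (simp add: m quadratic_form_def smul_def)
    then show ?thesis by blast
  next
    case 5
    then have "Poly_Mapping.single m c = quadratic_form 0 0 0 0 c 0"
      by (simp add: m quadratic_form_def smul_def)
    then show ?thesis by blast
  next
    case 6
    then have "Poly_Mapping.single m c = quadratic_form 0 0 0 0 0 c"
      by (simp add: m quadratic_form_def smul_def)
    then show ?thesis by blast
  qed
qed

lemma homogeneous_2_eq_quadratic_form:
  assumes "f \<in> homogeneous 2"
  shows "\<exists>A B C D E F. f = quadratic_form A B C D E F"
proof -
  have "\<exists>A B C D E F. (\<Sum>m\<in>M. Poly_Mapping.single m (Poly_Mapping.lookup f m)) = quadratic_form A B C D E F"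
    if "finite M" "M \<subseteq> Poly_Mapping.keys f" for M
    using that
  proof induction
    case empty
    have "0 = quadratic_form 0 0 0 0 0 (0 :: 'a)"
      by (simp add: quadratic_form_def smul_def)
    then show ?case by (metis sum.empty)
  next
    case (insert m M)
    then have "monom_degree m = 2" using assms by (auto simp: homogeneous_def)
    then obtain A B C D E F
      where "Poly_Mapping.single m (Poly_Mapping.lookup f m) = quadratic_form A B C D E F"
      using single_eq_quadratic_form by blast
    moreover obtain A' B' C' D' E' F'
      where "(\<Sum>m\<in>M. Poly_Mapping.single m (Poly_Mapping.lookup f m)) = quadratic_form A' B' C' D' E' F'"
      using insert by blast
    ultimately have "(\<Sum>m\<in>insert m M. Poly_Mapping.single m (Poly_Mapping.lookup f m)) =
        quadratic_form (A + A') (B + B') (C + C') (D + D') (E + E') (F + F')"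
      using insert.hyps by (simp add: quadratic_form_add)
    then show ?case by blast
  qed
  from this[OF finite_keys order_refl] show ?thesis by (simp add: sum_of_monomials)
qed

lemma linear_form_simps:
  "X = linear_form 1 0 0" "Y = linear_form 0 1 0" "smul r T = linear_form 0 0 r"
  "smul r (linear_form a b c) = linear_form (r * a) (r * b) (r * c)"
  "linear_form a b c + linear_form a' b' c' = linear_form (a + a') (b + b') (c + c')"
  by (simp_all add: linear_form_def smul_def algebra_simps)

lemma linear_form_cong:
  "a = a' \<Longrightarrow> b = b' \<Longrightarrow> c = c' \<Longrightarrow> linear_form a b c = linear_form a' b' c'"
  by simp

lemma pderiv3_linear_form:
  "pderiv3 i (linear_form a b c) = const (case i of Ix \<Rightarrow> a | Iy \<Rightarrow> b | It \<Rightarrow> c)"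
  by (cases i) (simp_all add: linear_form_def smul_def)

text \<open>
  The factor on the right is the determinant by which the substitution scales the Jacobian in \<open>X\<close>
  and \<open>Y\<close>. The relation therefore is finer than equivalence of ternary quadratic forms up to a
  scalar, and \<open>\<lambda> X Y\<close> keeps \<open>\<lambda>\<^sup>2\<close> as a modulus.
\<close>

definition linearly_equivalent :: "'k::comm_ring_1 poly3 \<Rightarrow> 'k poly3 \<Rightarrow> bool" where
  "linearly_equivalent f g \<longleftrightarrow>
     (\<exists>a b c a' b' c' d. a * b' - b * a' \<noteq> 0 \<and> d \<noteq> 0 \<and>
        substitute (linear_form a b c) (linear_form a' b' c') (smul d T) f =
          smul (a * b' - b * a') g)"

lemma jacobian_xy_substitute:
  fixes a b c a' b' c' d :: "'k::comm_ring_1"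
  defines "\<phi> \<equiv> substitute (linear_form a b c) (linear_form a' b' c') (smul d T)"
  shows "jacobian_xy (\<phi> p) (\<phi> q) = smul (a * b' - b * a') (\<phi> (jacobian_xy p q))"
proof -
  interpret algebra_endo \<phi> unfolding \<phi>_def by (rule algebra_endo_substitute)
  have var: "\<phi> X = linear_form a b c" "\<phi> Y = linear_form a' b' c'" "\<phi> T = linear_form 0 0 d"
    by (simp_all add: \<phi>_def linear_form_simps(3))
  show ?thesis
    unfolding jacobian_xy_def chain_rule[of _ p] chain_rule[of _ q] var
    by (simp add: pderiv3_linear_form smul_def algebra_simps)
qed

text \<open>
  Inverting the block triangular matrix by Cramer's rule gives the coefficients of \<open>\<psi>\<close>.
\<close>

lemma substitute_linear_inverse:
  fixes a b c a' b' c' d :: "'k::field"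
  defines "\<delta> \<equiv> a * b' - b * a'"
  defines "\<phi> \<equiv> substitute (linear_form a b c) (linear_form a' b' c') (smul d T)"
  defines "\<psi> \<equiv> substitute (linear_form (b' / \<delta>) (- b / \<delta>) ((b * c' - b' * c) / (\<delta> * d)))
     (linear_form (- a' / \<delta>) (a / \<delta>) ((a' * c - a * c') / (\<delta> * d))) (smul (1 / d) T)"
  assumes "\<delta> \<noteq> 0" "d \<noteq> 0"
  shows "\<phi> (\<psi> p) = p" "\<psi> (\<phi> p) = p"
proof -
  interpret \<phi>: algebra_endo \<phi> unfolding \<phi>_def by (rule algebra_endo_substitute)
  interpret \<psi>: algebra_endo \<psi> unfolding \<psi>_def by (rule algebra_endo_substitute)
  have id: "algebra_endo (\<lambda>p :: 'k poly3. p)" by unfold_locales simp_all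
  have T: "T = linear_form 0 0 (1 :: 'k)"
    by (simp add: linear_form_def smul_def)
  have \<phi>_var: "\<phi> X = linear_form a b c" "\<phi> Y = linear_form a' b' c'" "\<phi> T = linear_form 0 0 d"
    by (simp_all add: \<phi>_def linear_form_simps(3))
  have \<psi>_var: "\<psi> X = linear_form (b' / \<delta>) (- b / \<delta>) ((b * c' - b' * c) / (\<delta> * d))"
    "\<psi> Y = linear_form (- a' / \<delta>) (a / \<delta>) ((a' * c - a * c') / (\<delta> * d))"
    "\<psi> T = linear_form 0 0 (1 / d)"
    by (simp_all add: \<psi>_def linear_form_simps(3))
  have \<phi>_form: "\<phi> (linear_form x y z) =
      linear_form (x * a + y * a') (x * b + y * b') (x * c + y * c' + z * d)" for x y z
    unfolding linear_form_def[of x y z]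
    by (simp add: \<phi>_var linear_form_simps(4,5))
  have \<psi>_form: "\<psi> (linear_form x y z) =
      linear_form ((x * b' - y * a') / \<delta>) ((y * a - x * b) / \<delta>)
        ((x * (b * c' - b' * c) + y * (a' * c - a * c')) / (\<delta> * d) + z / d)" for x y z
    unfolding linear_form_def[of x y z]
    by (simp add: \<psi>_var linear_form_simps(4,5) diff_divide_distrib add_divide_distrib right_diff_distrib)
  have \<phi>\<psi>: "algebra_endo (\<lambda>p. \<phi> (\<psi> p))" and \<psi>\<phi>: "algebra_endo (\<lambda>p. \<psi> (\<phi> p))"
    by unfold_locales simp_all
  have \<delta>: "a * b' = \<delta> + b * a'" by (simp add: \<delta>_def)
  have \<delta>': "a * (b' * z) = \<delta> * z + b * (a' * z)" for z
    by (simp add: \<delta>_def algebra_simps)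
  have "\<phi> (\<psi> (var i)) = var i \<and> \<psi> (\<phi> (var i)) = var i" for i
  proof (cases i)
    case Ix
    show ?thesis
      unfolding Ix linear_form_simps(1) \<phi>_form \<psi>_form \<phi>_var \<psi>_var
      by (intro conjI linear_form_cong) (use assms(4,5) in \<open>simp_all add: field_simps \<delta> \<delta>'\<close>)
  next
    case Iy
    show ?thesis
      unfolding Iy linear_form_simps(2) \<phi>_form \<psi>_form \<phi>_var \<psi>_var
      by (intro conjI linear_form_cong) (use assms(4,5) in \<open>simp_all add: field_simps \<delta> \<delta>'\<close>)
  next
    case It
    then show ?thesis
      using assms(5) by (simp add: T \<phi>_form \<psi>_form)
  qed
  then show "\<phi> (\<psi> p) = p" "\<psi> (\<phi> p) = p"
    using algebra_endo_eqI[OF \<phi>\<psi> id] algebra_endo_eqI[OF \<psi>\<phi> id] by blast+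
qed

lemma linearly_equivalent_imp_isomorphic:
  fixes f g :: "'k::field poly3"
  assumes "linearly_equivalent f g"
  shows "poisson_isomorphic (planar_bracket f) (planar_bracket g)"
proof -
  obtain a b c a' b' c' d where nz: "a * b' - b * a' \<noteq> 0" "d \<noteq> 0"
    and fg: "substitute (linear_form a b c) (linear_form a' b' c') (smul d T) f =
      smul (a * b' - b * a') g"
    using assms by (auto simp: linearly_equivalent_def)
  define \<phi> where "\<phi> = substitute (linear_form a b c) (linear_form a' b' c') (smul d T)"
  interpret algebra_endo \<phi> unfolding \<phi>_def by (rule algebra_endo_substitute)
  have "bij \<phi>"
    unfolding \<phi>_def
    by (rule bijI') (metis substitute_linear_inverse[OF nz])+
  moreover have "Vector_Spaces.linear smul smul \<phi>"
    by (simp add: Vector_Spaces.linear_iff vector_space_smul)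
  moreover have "\<phi> (planar_bracket f p q) = planar_bracket g (\<phi> p) (\<phi> q)" for p q
  proof -
    have "\<phi> (planar_bracket f p q) = smul (a * b' - b * a') g * \<phi> (jacobian_xy p q)"
      by (simp add: planar_bracket_def fg[folded \<phi>_def])
    also have "\<dots> = g * jacobian_xy (\<phi> p) (\<phi> q)"
      unfolding \<phi>_def jacobian_xy_substitute by (simp add: smul_def)
    finally show ?thesis by (simp add: planar_bracket_def)
  qed
  ultimately show ?thesis
    unfolding poisson_isomorphic_def poisson_iso_def by auto
qed

section \<open>Hessians at the origin\<close>

definition hessian :: "'k::comm_ring_1 poly3 \<Rightarrow> indet \<Rightarrow> indet \<Rightarrow> 'k" where
  "hessian p i j = at_origin (pderiv3 i (pderiv3 j p))"

lemma at_origin_smul [simp]: "at_origin (smul c p) = c * at_origin p"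
  by (simp add: smul_def)

lemma at_origin_numeral [simp]: "at_origin (numeral n) = numeral n"
  using at_origin_const[of "numeral n"] by simp

lemma hessian_quadratic_form:
  "hessian (quadratic_form A B C D E F) Ix Ix = 2 * A"
  "hessian (quadratic_form A B C D E F) Iy Iy = 2 * C"
  "hessian (quadratic_form A B C D E F) It It = 2 * F"
  "hessian (quadratic_form A B C D E F) Ix Iy = B"
  "hessian (quadratic_form A B C D E F) Iy Ix = B"
  "hessian (quadratic_form A B C D E F) Ix It = D"
  "hessian (quadratic_form A B C D E F) It Ix = D"
  "hessian (quadratic_form A B C D E F) Iy It = E"
  "hessian (quadratic_form A B C D E F) It Iy = E"
  by (simp_all add: hessian_def quadratic_form_def power2_eq_square)

lemma quadratic_form_coefficients_eqI:
  fixes A :: "'k::field"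
  assumes "(2 :: 'k) \<noteq> 0"
    and "\<And>i j. hessian (quadratic_form A B C D E F) i j =
      hessian (quadratic_form A' B' C' D' E' F') i j"
  shows "A = A'" "B = B'" "C = C'" "D = D'" "E = E'" "F = F'"
  using assms(2)[of Ix Ix] assms(2)[of Ix Iy] assms(2)[of Iy Iy] assms(2)[of Ix It]
    assms(2)[of Iy It] assms(2)[of It It] assms(1)
  by (simp_all add: hessian_quadratic_form)

lemma quadratic_form_eqI:
  fixes A :: "'k::field"
  assumes "(2 :: 'k) \<noteq> 0"
    and "\<And>i j. hessian (quadratic_form A B C D E F) i j =
      hessian (quadratic_form A' B' C' D' E' F') i j"
  shows "quadratic_form A B C D E F = quadratic_form A' B' C' D' E' F'"
  using quadratic_form_coefficients_eqI[OF assms] by simp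

lemma quadratic_form_inject:
  fixes A :: "'k::field"
  assumes "(2 :: 'k) \<noteq> 0"
    and "quadratic_form A B C D E F = quadratic_form A' B' C' D' E' F'"
  shows "A = A'" "B = B'" "C = C'" "D = D'" "E = E'" "F = F'"
proof -
  have "hessian (quadratic_form A B C D E F) i j =
      hessian (quadratic_form A' B' C' D' E' F') i j" for i j
    by (simp only: assms(2))
  from quadratic_form_coefficients_eqI[OF assms(1) this]
  show "A = A'" "B = B'" "C = C'" "D = D'" "E = E'" "F = F'" .
qed

lemma hessian_0 [simp]: "hessian 0 i j = 0"
  by (simp add: hessian_def)

lemma pderiv3_quadratic_form:
  "pderiv3 Ix (quadratic_form A B C D E F) = linear_form (2 * A) B D"
  "pderiv3 Iy (quadratic_form A B C D E F) = linear_form B (2 * C) E"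
  "pderiv3 It (quadratic_form A B C D E F) = linear_form D E (2 * F)"
  by (simp_all add: quadratic_form_def linear_form_def power2_eq_square smul_def algebra_simps)

lemma at_origin_quadratic_form [simp]: "at_origin (quadratic_form A B C D E F) = 0"
  by (simp add: quadratic_form_def power2_eq_square)

lemma at_origin_linear_form [simp]: "at_origin (linear_form a b c) = 0"
  by (simp add: linear_form_def)

lemma at_origin_pderiv3_quadratic_form [simp]:
  "at_origin (pderiv3 i (quadratic_form A B C D E F)) = 0"
  by (cases i) (simp_all add: pderiv3_quadratic_form)

lemma pderiv3_pderiv3_quadratic_form:
  assumes "f = quadratic_form A B C D E F"
  shows "pderiv3 i (pderiv3 j f) = const (hessian f i j)"
  unfolding hessian_def assms
  by (cases j) (simp_all add: pderiv3_quadratic_form pderiv3_linear_form)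

text \<open>
  A quadratic form and its first derivatives vanish at the origin, so the product rule leaves one term.
\<close>

lemma hessian_quadratic_form_mult:
  "hessian (quadratic_form A B C D E F * h) i j =
     hessian (quadratic_form A B C D E F) i j * at_origin h"
  by (simp add: hessian_def)

context algebra_endo
begin

text \<open>
  By the chain rule, a tangent vector \<open>z\<close> at the origin killed by the differential of \<open>\<phi>\<close> annihilates
  every polynomial in the image of \<open>\<phi>\<close>. If \<open>\<phi>\<close> is surjective, these include the variables, whose
  derivatives along \<open>z\<close> are its coordinates.
\<close>

lemma jacobian_at_origin_injective:
  assumes "surj \<phi>"
    and "\<And>k. zx * at_origin (pderiv3 Ix (\<phi> (var k))) + zy * at_origin (pderiv3 Iy (\<phi> (var k)))
           + zt * at_origin (pderiv3 It (\<phi> (var k))) = 0"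
  shows "zx = 0" "zy = 0" "zt = 0"
proof -
  have "zx * at_origin (pderiv3 Ix (\<phi> p)) + zy * at_origin (pderiv3 Iy (\<phi> p))
      + zt * at_origin (pderiv3 It (\<phi> p)) = 0" for p
  proof -
    have "zx * at_origin (pderiv3 Ix (\<phi> p)) + zy * at_origin (pderiv3 Iy (\<phi> p))
        + zt * at_origin (pderiv3 It (\<phi> p)) =
      at_origin (\<phi> (pderiv3 Ix p)) * (zx * at_origin (pderiv3 Ix (\<phi> X))
        + zy * at_origin (pderiv3 Iy (\<phi> X)) + zt * at_origin (pderiv3 It (\<phi> X))) +
      at_origin (\<phi> (pderiv3 Iy p)) * (zx * at_origin (pderiv3 Ix (\<phi> Y))
        + zy * at_origin (pderiv3 Iy (\<phi> Y)) + zt * at_origin (pderiv3 It (\<phi> Y))) +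
      at_origin (\<phi> (pderiv3 It p)) * (zx * at_origin (pderiv3 Ix (\<phi> T))
        + zy * at_origin (pderiv3 Iy (\<phi> T)) + zt * at_origin (pderiv3 It (\<phi> T)))"
      unfolding chain_rule[of _ p] by (simp add: algebra_simps)
    then show ?thesis unfolding assms(2) by simp
  qed
  then have "zx * at_origin (pderiv3 Ix q) + zy * at_origin (pderiv3 Iy q)
      + zt * at_origin (pderiv3 It q) = 0" for q
    using assms(1) by (metis surjD)
  from this[of X] this[of Y] this[of T] show "zx = 0" "zy = 0" "zt = 0" by simp_all
qed

text \<open>
  The second derivatives of \<open>\<phi>\<close> enter the second-order chain rule multiplied by first derivatives of
  \<open>f\<close> at the image point. At a critical point they disappear, and \<open>\<phi>\<close> acts on the Hessian through
  its differential \<open>L\<close> alone.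
\<close>

lemma hessian_chain_rule:
  assumes f: "f = quadratic_form A B C D E F"
    and critical: "\<And>k. at_origin (\<phi> (pderiv3 k f)) = 0"
  defines "L \<equiv> \<lambda>k i. at_origin (pderiv3 i (\<phi> (var k)))"
  shows "hessian (\<phi> f) i j =
     (hessian f Ix Ix * L Ix i + hessian f Iy Ix * L Iy i + hessian f It Ix * L It i) * L Ix j +
     (hessian f Ix Iy * L Ix i + hessian f Iy Iy * L Iy i + hessian f It Iy * L It i) * L Iy j +
     (hessian f Ix It * L Ix i + hessian f Iy It * L Iy i + hessian f It It * L It i) * L It j"
proof -
  have grad: "at_origin (pderiv3 i (\<phi> (pderiv3 k f))) =
      hessian f Ix k * L Ix i + hessian f Iy k * L Iy i + hessian f It k * L It i" for k
    unfolding chain_rule[of i "pderiv3 k f"] by (simp add: pderiv3_pderiv3_quadratic_form[OF f] L_def)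
  show ?thesis
    unfolding hessian_def[of "\<phi> f"] chain_rule[of j f]
    by (simp add: critical grad) (simp add: L_def)
qed

end

section \<open>Poisson isomorphism is linear equivalence\<close>

lemma substitute_quadratic_form:
  "substitute (linear_form a b c) (linear_form a' b' c') (smul d T) (quadratic_form A B C D E F) =
     quadratic_form
       (A * a^2 + B * a * a' + C * a'^2)
       (2 * A * a * b + B * (a * b' + b * a') + 2 * C * a' * b')
       (A * b^2 + B * b * b' + C * b'^2)
       (2 * A * a * c + B * (a * c' + c * a') + 2 * C * a' * c' + (D * a + E * a') * d)
       (2 * A * b * c + B * (b * c' + c * b') + 2 * C * b' * c' + (D * b + E * b') * d)
       (A * c^2 + B * c * c' + C * c'^2 + (D * c + E * c') * d + F * d^2)"
proof -
  interpret algebra_endo "substitute (linear_form a b c) (linear_form a' b' c') (smul d T)"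
    by (rule algebra_endo_substitute)
  show ?thesis
    by (simp add: quadratic_form_def) (simp add: linear_form_def smul_def algebra_simps power2_eq_square)
qed

lemma smul_quadratic_form:
  "smul r (quadratic_form A B C D E F) =
     quadratic_form (r * A) (r * B) (r * C) (r * D) (r * E) (r * F)"
  by (simp add: quadratic_form_def smul_def algebra_simps)

lemma poisson_isomorphic_refl: "poisson_isomorphic br br"
  unfolding poisson_isomorphic_def poisson_iso_def
  by (rule exI[of _ "\<lambda>p. p"]) (simp add: Vector_Spaces.linear_iff vector_space_smul bij_def)

lemma poisson_isomorphic_sym:
  assumes "poisson_isomorphic br br'"
  shows "poisson_isomorphic br' br"
proof -
  obtain \<phi> where \<phi>: "poisson_iso smul br smul br' \<phi>"
    using assms by (auto simp: poisson_isomorphic_def)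
  define \<psi> where "\<psi> = inv \<phi>"
  have bij: "bij \<phi>" and hom: "\<phi> (p + q) = \<phi> p + \<phi> q" "\<phi> (smul r p) = smul r (\<phi> p)"
    "\<phi> 1 = 1" "\<phi> (p * q) = \<phi> p * \<phi> q" "\<phi> (br p q) = br' (\<phi> p) (\<phi> q)" for p q r
    using \<phi> by (auto simp: poisson_iso_def Vector_Spaces.linear_iff)
  have "bij \<psi>" unfolding \<psi>_def using bij by (rule bij_imp_bij_inv)
  moreover have "\<phi> (\<psi> q) = q" "\<psi> (\<phi> p) = p" for p q
    using bij by (simp_all add: \<psi>_def bij_is_inj bij_is_surj surj_f_inv_f)
  then have "\<psi> (p + q) = \<psi> p + \<psi> q" "\<psi> (smul r p) = smul r (\<psi> p)"
    "\<psi> 1 = 1" "\<psi> (p * q) = \<psi> p * \<psi> q" "\<psi> (br' p q) = br (\<psi> p) (\<psi> q)" for p q r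
    by (metis hom)+
  ultimately show ?thesis
    unfolding poisson_isomorphic_def poisson_iso_def
    by (intro exI[of _ \<psi>]) (simp add: Vector_Spaces.linear_iff vector_space_smul)
qed

lemma jacobian_xy_var: "jacobian_xy X Y = 1" "jacobian_xy X T = 0" "jacobian_xy Y T = 0"
  by (simp_all add: jacobian_xy_def)

text \<open>
  The differential at the origin of an arbitrary isomorphism is a linear equivalence; the argument
  is outlined at the beginning. Its two nondegeneracy statements and the shape of \<open>L\<close> come from
  feeding explicit vectors into \<open>jacobian_at_origin_injective\<close>. If the Hessian of \<open>g\<close> vanishes,
  there is nothing to compare, but then both brackets are zero.
\<close>

lemma isomorphic_imp_linearly_equivalent:
  fixes f g :: "'k::field poly3"
  assumes two: "(2 :: 'k) \<noteq> 0"
    and f: "f = quadratic_form A B C D E F"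
    and g: "g = quadratic_form A' B' C' D' E' F'"
    and iso: "poisson_isomorphic (planar_bracket f) (planar_bracket g)"
  shows "linearly_equivalent f g"
proof -
  obtain \<phi> where \<phi>: "poisson_iso smul (planar_bracket f) smul (planar_bracket g) \<phi>"
    using iso by (auto simp: poisson_isomorphic_def)
  have bij: "bij \<phi>" and smul: "\<phi> (smul r p) = smul r (\<phi> p)" and one: "\<phi> 1 = 1"
    and bracket: "\<phi> (f * jacobian_xy p q) = g * jacobian_xy (\<phi> p) (\<phi> q)" for p q r
    using \<phi> by (auto simp: poisson_iso_def Vector_Spaces.linear_iff planar_bracket_def)
  interpret algebra_endo \<phi>
  proof
    show "\<phi> (const c) = const c" for c
      using smul[of c 1] by (simp add: smul_def one)
  qed (use \<phi> in \<open>auto simp: poisson_iso_def Vector_Spaces.linear_iff\<close>)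
  have \<phi>f: "\<phi> f = g * jacobian_xy (\<phi> X) (\<phi> Y)"
    and XT: "g * jacobian_xy (\<phi> X) (\<phi> T) = 0" and YT: "g * jacobian_xy (\<phi> Y) (\<phi> T) = 0"
    using bracket[of X Y] bracket[of X T] bracket[of Y T] by (simp_all add: jacobian_xy_var)
  show ?thesis
  proof (cases "\<forall>i j. hessian g i j = 0")
    case True
    have "hessian (quadratic_form A' B' C' D' E' F') i j = hessian (quadratic_form 0 0 0 0 0 (0::'k)) i j" for i j
      using True by (simp add: g[symmetric]) (simp add: quadratic_form_def smul_def)
    from quadratic_form_eqI[OF two this] have "g = 0"
      by (simp add: g quadratic_form_def smul_def)
    moreover from this have "f = 0"
      using \<phi>f bij by (metis bij_pointE mult_zero_left zero)
    moreover have "linearly_equivalent 0 (0 :: 'k poly3)"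
      unfolding linearly_equivalent_def
      by (rule exI[of _ 1], rule exI[of _ 0], rule exI[of _ 0], rule exI[of _ 0], rule exI[of _ 1],
          rule exI[of _ 0], rule exI[of _ 1]) (simp add: substitute_def smul_def)
    ultimately show ?thesis by simp
  next
    case False
    then obtain i\<^sub>0 j\<^sub>0 where nz: "hessian g i\<^sub>0 j\<^sub>0 \<noteq> 0" by blast
    \<comment> \<open>A nonzero second derivative of \<open>g\<close> allows cancelling \<open>g\<close> in values at the origin.\<close>
    have cancel: "at_origin h = 0" if "g * h = 0" for h
      using hessian_quadratic_form_mult[of A' B' C' D' E' F' h i\<^sub>0 j\<^sub>0] nz that
      by (simp add: g)
    define L where "L k i = at_origin (pderiv3 i (\<phi> (var k)))" for k i
    note L = jacobian_at_origin_injective[OF bij_is_surj[OF bij], folded L_def]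
    define \<delta> where "\<delta> = L Ix Ix * L Iy Iy - L Ix Iy * L Iy Ix"
    have J0: "at_origin (jacobian_xy (\<phi> X) (\<phi> Y)) = \<delta>"
      by (simp add: jacobian_xy_def L_def \<delta>_def)
    have XT0: "L Ix Ix * L It Iy - L Ix Iy * L It Ix = 0"
      and YT0: "L Iy Ix * L It Iy - L Iy Iy * L It Ix = 0"
      using cancel[OF XT] cancel[OF YT] by (simp_all add: jacobian_xy_def L_def)
    have T0: "L It Ix = 0" "L It Iy = 0"
    proof -
      \<comment> \<open>The vector \<open>(w\<^sub>y, - w\<^sub>x, 0)\<close> with \<open>w = \<phi> T\<close> is killed by \<open>L\<close>, as \<open>w\<close> commutes with \<open>\<phi> X\<close> and \<open>\<phi> Y\<close>.\<close>
      have *: "L It Iy * L k Ix + (- L It Ix) * L k Iy + 0 * L k It = 0" for k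
        using XT0 YT0 by (cases k) (simp_all add: algebra_simps)
      show "L It Ix = 0" "L It Iy = 0"
        using L[OF *] by simp_all
    qed
    have \<delta>: "\<delta> \<noteq> 0"
    proof
      assume 0: "\<delta> = 0"
      \<comment> \<open>If the block in \<open>X\<close> and \<open>Y\<close> is singular, the same vectors for \<open>\<phi> X\<close> and \<open>\<phi> Y\<close> show that it
        vanishes.\<close>
      have *: "L k' Iy * L k Ix + (- L k' Ix) * L k Iy + 0 * L k It = 0" for k k'
        using 0 T0 by (cases k; cases k') (simp_all add: \<delta>_def algebra_simps)
      have "L k Ix = 0" for k
        using L(2)[OF *, of k] by simp
      then have *: "1 * L k Ix + 0 * L k Iy + 0 * L k It = 0" for k
        by simp
      show False using L(1)[OF *] by simp
    qed
    have d: "L It It \<noteq> 0"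
    proof
      assume 0: "L It It = 0"
      \<comment> \<open>The vector is the cross product of the first two rows of \<open>L\<close>.\<close>
      have *: "(L Ix Iy * L Iy It - L Ix It * L Iy Iy) * L k Ix +
          (L Ix It * L Iy Ix - L Ix Ix * L Iy It) * L k Iy + \<delta> * L k It = 0" for k
        using 0 T0 by (cases k) (simp_all add: \<delta>_def algebra_simps)
      show False using L(3)[OF *] \<delta> by simp
    qed
    have critical: "at_origin (\<phi> (pderiv3 k f)) = 0" for k
    proof -
      define c where "c k = at_origin (\<phi> (pderiv3 k f))" for k
      have eq: "c Ix * L Ix i + c Iy * L Iy i + c It * L It i = 0" for i
      proof -
        have "at_origin (pderiv3 i (\<phi> f)) = 0"
          unfolding \<phi>f by (simp add: g)
        then show ?thesis
          unfolding chain_rule[of i f] by (simp add: c_def L_def)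
      qed
      \<comment> \<open>The gradient of \<open>f\<close> at the image of the origin solves a linear system with matrix \<open>L\<close>.\<close>
      have "\<delta> * c Ix = (c Ix * L Ix Ix + c Iy * L Iy Ix) * L Iy Iy - (c Ix * L Ix Iy + c Iy * L Iy Iy) * L Iy Ix"
        and "\<delta> * c Iy = (c Ix * L Ix Iy + c Iy * L Iy Iy) * L Ix Ix - (c Ix * L Ix Ix + c Iy * L Iy Ix) * L Ix Iy"
        by (simp_all add: \<delta>_def algebra_simps)
      moreover have "c Ix * L Ix Ix + c Iy * L Iy Ix = 0" "c Ix * L Ix Iy + c Iy * L Iy Iy = 0"
        using eq[of Ix] eq[of Iy] T0 by simp_all
      ultimately have "\<delta> * c Ix = 0" "\<delta> * c Iy = 0"
        by simp_all
      then have "c Ix = 0" "c Iy = 0"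
        using \<delta> by simp_all
      moreover from this have "c It = 0"
        using eq[of It] d by simp
      ultimately show ?thesis
        by (cases k) (simp_all add: c_def)
    qed
    \<comment> \<open>The linear map \<open>L\<close> itself, as a substitution: it has the same differential as \<open>\<phi>\<close>.\<close>
    define \<chi> where "\<chi> = substitute (linear_form (L Ix Ix) (L Ix Iy) (L Ix It))
      (linear_form (L Iy Ix) (L Iy Iy) (L Iy It)) (smul (L It It) T)"
    interpret \<chi>: algebra_endo \<chi>
      unfolding \<chi>_def by (rule algebra_endo_substitute)
    have \<chi>_var: "\<chi> X = linear_form (L Ix Ix) (L Ix Iy) (L Ix It)"
      "\<chi> Y = linear_form (L Iy Ix) (L Iy Iy) (L Iy It)" "\<chi> T = linear_form 0 0 (L It It)"
      by (simp_all add: \<chi>_def linear_form_simps(3))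
    have \<chi>_linear: "at_origin (\<chi> (linear_form a b c)) = 0" for a b c
      unfolding linear_form_def[of a b c] by (simp add: \<chi>_var)
    have \<chi>_critical: "at_origin (\<chi> (pderiv3 k f)) = 0" for k
      by (cases k) (simp_all add: f pderiv3_quadratic_form \<chi>_linear)
    have \<chi>_L: "at_origin (pderiv3 i (\<chi> (var k))) = L k i" for i k
      by (cases k; cases i) (simp_all add: \<chi>_var pderiv3_linear_form T0)
    have "hessian (\<chi> f) i j = hessian (\<phi> f) i j" for i j
      unfolding hessian_chain_rule[OF f critical] \<chi>.hessian_chain_rule[OF f \<chi>_critical] \<chi>_L
      by (simp add: L_def)
    also have "hessian (\<phi> f) i j = hessian (smul \<delta> g) i j" for i j
      unfolding \<phi>f g hessian_quadratic_form_mult J0 by (simp add: hessian_def)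
    finally have "hessian (\<chi> f) i j = hessian (smul \<delta> g) i j" for i j .
    then have "\<chi> f = smul \<delta> g"
      unfolding \<chi>_def f g smul_quadratic_form substitute_quadratic_form
      by (rule quadratic_form_eqI[OF two])
    then show ?thesis
      using \<delta> d unfolding linearly_equivalent_def \<chi>_def \<delta>_def by blast
  qed
qed

section \<open>Reduction to normal forms\<close>

lemma linearly_equivalentI:
  assumes "a * b' - b * a' = \<delta>" "\<delta> \<noteq> 0" "d \<noteq> 0"
    and "A * a^2 + B * a * a' + C * a'^2 = \<delta> * A'"
    and "2 * A * a * b + B * (a * b' + b * a') + 2 * C * a' * b' = \<delta> * B'"
    and "A * b^2 + B * b * b' + C * b'^2 = \<delta> * C'"
    and "2 * A * a * c + B * (a * c' + c * a') + 2 * C * a' * c' + (D * a + E * a') * d = \<delta> * D'"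
    and "2 * A * b * c + B * (b * c' + c * b') + 2 * C * b' * c' + (D * b + E * b') * d = \<delta> * E'"
    and "A * c^2 + B * c * c' + C * c'^2 + (D * c + E * c') * d + F * d^2 = \<delta> * F'"
  shows "linearly_equivalent (quadratic_form A B C D E F) (quadratic_form A' B' C' D' E' F')"
proof -
  have "substitute (linear_form a b c) (linear_form a' b' c') (smul d T) (quadratic_form A B C D E F) =
      smul (a * b' - b * a') (quadratic_form A' B' C' D' E' F')"
    unfolding substitute_quadratic_form smul_quadratic_form assms(1) assms(4-) ..
  then show ?thesis
    using assms(1-3) unfolding linearly_equivalent_def by blast
qed

lemma linearly_equivalentE:
  fixes A :: "'k::field"
  assumes "(2 :: 'k) \<noteq> 0"
    and "linearly_equivalent (quadratic_form A B C D E F) (quadratic_form A' B' C' D' E' F')"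
  obtains a b c a' b' c' d \<delta>
  where "\<delta> = a * b' - b * a'" "\<delta> \<noteq> 0" "d \<noteq> 0"
    and "A * a^2 + B * a * a' + C * a'^2 = \<delta> * A'"
    and "2 * A * a * b + B * (a * b' + b * a') + 2 * C * a' * b' = \<delta> * B'"
    and "A * b^2 + B * b * b' + C * b'^2 = \<delta> * C'"
    and "2 * A * a * c + B * (a * c' + c * a') + 2 * C * a' * c' + (D * a + E * a') * d = \<delta> * D'"
    and "2 * A * b * c + B * (b * c' + c * b') + 2 * C * b' * c' + (D * b + E * b') * d = \<delta> * E'"
    and "A * c^2 + B * c * c' + C * c'^2 + (D * c + E * c') * d + F * d^2 = \<delta> * F'"
proof -
  obtain a b c a' b' c' d where "a * b' - b * a' \<noteq> 0" "d \<noteq> 0" and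
    eq: "substitute (linear_form a b c) (linear_form a' b' c') (smul d T) (quadratic_form A B C D E F) =
      smul (a * b' - b * a') (quadratic_form A' B' C' D' E' F')"
    using assms(2) unfolding linearly_equivalent_def by blast
  then show thesis
    using quadratic_form_inject[OF assms(1) eq[unfolded substitute_quadratic_form smul_quadratic_form]]
    by (intro that[of "a * b' - b * a'" a b' b a' d c c']) simp_all
qed

lemma normal_forms_eq:
  "0 = quadratic_form 0 0 0 0 0 0"
  "T\<^sup>2 = quadratic_form 0 0 0 0 0 1"
  "X * T = quadratic_form 0 0 0 1 0 0"
  "X\<^sup>2 = quadratic_form 1 0 0 0 0 0"
  "X\<^sup>2 + T\<^sup>2 = quadratic_form 1 0 0 0 0 1"
  "X\<^sup>2 + Y * T = quadratic_form 1 0 0 0 1 0"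
  "smul l (X * Y) = quadratic_form 0 l 0 0 0 0"
  "smul l (X * Y) + T\<^sup>2 = quadratic_form 0 l 0 0 0 1"
  by (simp_all add: quadratic_form_def smul_def)

lemma normal_forms_cases:
  assumes "g \<in> normal_forms"
  obtains (zero) "g = quadratic_form 0 0 0 0 0 0"
  | (t2) "g = quadratic_form 0 0 0 0 0 1"
  | (xt) "g = quadratic_form 0 0 0 1 0 0"
  | (x2) "g = quadratic_form 1 0 0 0 0 0"
  | (x2t2) "g = quadratic_form 1 0 0 0 0 1"
  | (x2yt) "g = quadratic_form 1 0 0 0 1 0"
  | (xy) l where "l \<noteq> 0" "g = quadratic_form 0 l 0 0 0 0"
  | (xyt2) l where "l \<noteq> 0" "g = quadratic_form 0 l 0 0 0 1"
  using assms unfolding normal_forms_def normal_forms_eq(1-6)[symmetric] unfolding normal_forms_eq(7,8)[symmetric]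
  by blast

lemma normal_formsI:
  "quadratic_form 0 0 0 0 0 0 \<in> normal_forms"
  "quadratic_form 0 0 0 0 0 1 \<in> normal_forms"
  "quadratic_form 0 0 0 1 0 0 \<in> normal_forms"
  "quadratic_form 1 0 0 0 0 0 \<in> normal_forms"
  "quadratic_form 1 0 0 0 0 1 \<in> normal_forms"
  "quadratic_form 1 0 0 0 1 0 \<in> normal_forms"
  "l \<noteq> 0 \<Longrightarrow> quadratic_form 0 l 0 0 0 0 \<in> normal_forms"
  "l \<noteq> 0 \<Longrightarrow> quadratic_form 0 l 0 0 0 1 \<in> normal_forms"
  unfolding normal_forms_def normal_forms_eq(1-6)[symmetric] unfolding normal_forms_eq(7,8)[symmetric]
  by blast+

lemma square_root_exists:
  obtains s :: "'k::alg_closed_field" where "s^2 = r"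
  using nth_root_exists[of 2 r] by auto

text \<open>
  A binary quadratic form over an algebraically closed field is a product of two linear forms; when
  these are proportional, the scalar between them is absorbed by a square root.
\<close>

lemma binary_quadratic_form_cases:
  fixes A B C :: "'k::alg_closed_field"
  obtains (zero) "A = 0" "B = 0" "C = 0"
  | (square) a b where "a \<noteq> 0 \<or> b \<noteq> 0" "A = a^2" "B = 2 * a * b" "C = b^2"
  | (split) a b a' b' where "a * b' - b * a' \<noteq> 0" "A = a * a'" "B = a * b' + b * a'" "C = b * b'"
proof (cases "A = 0")
  case True
  show ?thesis
  proof (cases "B = 0")
    case B: True
    obtain s where "s^2 = C" using square_root_exists .
    with True B show ?thesis
      by (cases "C = 0") (auto intro: zero square[of 0 s])
  next
    case False
    with True show ?thesis
      by (intro split[of 0 C 1 B]) auto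
  qed
next
  case False
  obtain r where "poly [:C, B, A:] r = 0"
    using alg_closed_imp_poly_has_root[of "[:C, B, A:]"] False by auto
  then have r: "C = - r * (B + A * r)"
    by (simp add: algebra_simps eq_neg_iff_add_eq_0)
  show ?thesis
  proof (cases "B + 2 * A * r = 0")
    case True
    then have B: "B = - 2 * A * r" by (simp add: eq_neg_iff_add_eq_0)
    obtain s where s: "s^2 = A" using square_root_exists .
    with False r B show ?thesis
      by (intro square[of s "- s * r"]) (auto simp: power2_eq_square algebra_simps)
  next
    case False
    with r show ?thesis
      by (intro split[of 1 "B + A * r" "- r" A]) (auto simp: algebra_simps)
  qed
qed

text \<open>
  The substitution goes from the normal form to the given form, so that its linear forms can be
  read off from a factorisation of the given form. The shape of the part without \<open>T\<close> selects the
  group of normal forms. A split part \<open>u v\<close> absorbs both mixed terms by shifting \<open>u\<close> and \<open>v\<close> by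
  multiples of \<open>T\<close>. A square \<open>u\<^sup>2\<close> absorbs them if \<open>D X + E Y\<close> is proportional to \<open>u\<close>; otherwise
  \<open>D X + E Y + F T\<close> is a coordinate independent of \<open>u\<close>, which leads to \<open>X\<^sup>2 + Y T\<close>. If there is
  no part without \<open>T\<close>, then \<open>T\<close> divides the form.
\<close>

lemma linearly_equivalent_to_normal_form:
  fixes A :: "'k::alg_closed_field"
  assumes two: "(2 :: 'k) \<noteq> 0"
  shows "\<exists>g\<in>normal_forms. linearly_equivalent g (quadratic_form A B C D E F)"
proof (cases A B C rule: binary_quadratic_form_cases)
  case zero
  show ?thesis
  proof (cases "D = 0 \<and> E = 0")
    case True
    obtain s where s: "s^2 = F" using square_root_exists .
    show ?thesis
    proof (cases "F = 0")
      case F: True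
      have "linearly_equivalent (quadratic_form 0 0 0 0 0 0) (quadratic_form A B C D E F)"
        using True zero F by (intro linearly_equivalentI[where a = 1 and b' = 1 and b = 0 and a' = 0
              and \<delta> = 1 and d = 1 and c = 0 and c' = 0]) simp_all
      then show ?thesis using normal_formsI(1) by blast
    next
      case False
      have "linearly_equivalent (quadratic_form 0 0 0 0 0 1) (quadratic_form A B C D E F)"
        using True zero False s by (intro linearly_equivalentI[where a = 1 and b' = 1 and b = 0 and a' = 0
              and \<delta> = 1 and d = s and c = 0 and c' = 0]) auto
      then show ?thesis using normal_formsI(2) by blast
    qed
  next
    case False
    obtain a' b' where "D * b' - E * a' = 1"
    proof (cases "D = 0")
      case True
      with False show ?thesis by (intro that[of 0 "- 1 / E"]) auto
    next
      case False
      then show ?thesis by (intro that[of "1 / D" 0]) auto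
    qed
    then have "linearly_equivalent (quadratic_form 0 0 0 1 0 0) (quadratic_form A B C D E F)"
      using zero by (intro linearly_equivalentI[where a = D and b' = b' and b = E and a' = a'
              and \<delta> = 1 and d = 1 and c = F and c' = 0]) simp_all
    then show ?thesis using normal_formsI(3) by blast
  qed
next
  case (square a b)
  define e where "e = a * E - b * D"
  show ?thesis
  proof (cases "e = 0")
    case True
    obtain c where c: "2 * a * c = D" "2 * b * c = E"
    proof (cases "a = 0")
      case a: True
      with True square two show ?thesis
        by (intro that[of "E / (2 * b)"]) (auto simp: e_def)
    next
      case False
      with True two show ?thesis
        by (intro that[of "D / (2 * a)"]) (auto simp: e_def field_simps)
    qed
    obtain a' b' where 1: "a * b' - b * a' = 1"
    proof (cases "a = 0")
      case a: True
      with square show ?thesis by (intro that[of 0 "- 1 / b"]) auto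
    next
      case False
      then show ?thesis by (intro that[of "1 / a" 0]) auto
    qed
    show ?thesis
    proof (cases "F = c^2")
      case F: True
      have "linearly_equivalent (quadratic_form 1 0 0 0 0 0) (quadratic_form A B C D E F)"
        using square c 1 F by (intro linearly_equivalentI[where a = a and b' = b' and b = b and a' = a'
              and \<delta> = 1 and d = 1 and c = c and c' = 0]) simp_all
      then show ?thesis using normal_formsI(4) by blast
    next
      case False
      obtain s where s: "s^2 = F - c^2" using square_root_exists .
      have "linearly_equivalent (quadratic_form 1 0 0 0 0 1) (quadratic_form A B C D E F)"
        using square c 1 False s
        by (intro linearly_equivalentI[where a = a and b' = b' and b = b and a' = a'
              and \<delta> = 1 and d = s and c = c and c' = 0]) auto
      then show ?thesis using normal_formsI(5) by blast
    qed
  next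
    case False
    \<comment> \<open>Rescaling the coordinates \<open>a X + b Y\<close>, \<open>D X + E Y + F T\<close> and \<open>T\<close> by \<open>e\<close>, \<open>1\<close> and \<open>e\<^sup>2\<close>
      scales both terms of the form by \<open>e\<^sup>2\<close>, and makes the determinant equal to \<open>e\<^sup>2\<close>.\<close>
    have "e * a * E - e * b * D = e\<^sup>2"
      by (simp add: e_def power2_eq_square algebra_simps)
    with square False
    have "linearly_equivalent (quadratic_form 1 0 0 0 1 0) (quadratic_form A B C D E F)"
      by (intro linearly_equivalentI[where a = "e * a" and b' = E and b = "e * b" and a' = D
            and \<delta> = "e\<^sup>2" and d = "e\<^sup>2" and c = 0 and c' = F])
         (simp_all add: power2_eq_square algebra_simps)
    then show ?thesis using normal_formsI(6) by blast
  qed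
next
  case (split a b a' b')
  define \<delta> where "\<delta> = a * b' - b * a'"
  \<comment> \<open>The shifts by multiples of \<open>T\<close> solve a linear system with determinant \<open>\<plusminus> \<delta>\<close>.\<close>
  define c where "c = (a * E - b * D) / \<delta>"
  define c' where "c' = (D * b' - E * a') / \<delta>"
  have \<delta>: "\<delta> \<noteq> 0" using split by (simp add: \<delta>_def)
  have D: "a * c' + c * a' = D"
  proof -
    have "a * c' + c * a' = D * \<delta> / \<delta>"
      unfolding c_def c'_def \<delta>_def
      by (simp add: algebra_simps add_divide_distrib[symmetric] diff_divide_distrib[symmetric])
    then show ?thesis using \<delta> by simp
  qed
  have E: "b * c' + c * b' = E"
  proof -
    have "b * c' + c * b' = E * \<delta> / \<delta>"
      unfolding c_def c'_def \<delta>_def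
      by (simp add: algebra_simps add_divide_distrib[symmetric] diff_divide_distrib[symmetric])
    then show ?thesis using \<delta> by simp
  qed
  show ?thesis
  proof (cases "F = c * c'")
    case True
    have "linearly_equivalent (quadratic_form 0 \<delta> 0 0 0 0) (quadratic_form A B C D E F)"
      using split \<delta> D E True
      by (intro linearly_equivalentI[where a = a and b' = b' and b = b and a' = a'
              and \<delta> = \<delta> and d = 1 and c = c and c' = c']) (simp_all add: \<delta>_def)
    then show ?thesis using normal_formsI(7)[OF \<delta>] by blast
  next
    case False
    obtain s where s: "s^2 = \<delta> * (F - c * c')" using square_root_exists .
    have "s \<noteq> 0" using s \<delta> False by auto
    moreover have "a * b' - b * a' = \<delta>" by (simp add: \<delta>_def)
    ultimately have "linearly_equivalent (quadratic_form 0 \<delta> 0 0 0 1) (quadratic_form A B C D E F)"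
      using split(2-) \<delta> D E s
      by (intro linearly_equivalentI[where a = a and b' = b' and b = b and a' = a'
            and \<delta> = \<delta> and d = s and c = c and c' = c'])
         (assumption | simp add: algebra_simps)+
    then show ?thesis using normal_formsI(8)[OF \<delta>] by blast
  qed
qed

section \<open>Telling the normal forms apart\<close>

text \<open>
  The discriminant of a binary form picks up the square of the determinant under substitution, and
  the same factor under multiplication of the form by the determinant.
\<close>

lemma discriminant_invariant:
  fixes A :: "'k::field"
  assumes two: "(2 :: 'k) \<noteq> 0"
    and equiv: "linearly_equivalent (quadratic_form A B C D E F) (quadratic_form A' B' C' D' E' F')"
  shows "B'\<^sup>2 - 4 * A' * C' = B\<^sup>2 - 4 * A * C"
proof (cases rule: linearly_equivalentE[OF two equiv])
  case (1 a b c a' b' c' d \<delta>)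
  have "\<delta>\<^sup>2 * (B'\<^sup>2 - 4 * A' * C') = (\<delta> * B')\<^sup>2 - 4 * (\<delta> * A') * (\<delta> * C')"
    by (simp add: power2_eq_square algebra_simps)
  also have "\<dots> = \<delta>\<^sup>2 * (B\<^sup>2 - 4 * A * C)"
    unfolding 1(4-6)[symmetric] unfolding 1(1)
    by (simp add: power2_eq_square algebra_simps)
  finally show ?thesis using 1(2) by simp
qed

text \<open>
  Consequences of linear equivalence for particular sources. The first three say that the zero form,
  multiples of \<open>T\<^sup>2\<close> and multiples of \<open>T\<close> stay such; only a coefficient is recorded that
  separates normal forms. The others are relations between the coefficients of a target that
  is a multiple of \<open>u\<^sup>2\<close> plus a multiple of \<open>T\<^sup>2\<close>, a multiple of \<open>u\<^sup>2\<close>, or a product of two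
  linear forms, for which the ternary determinant vanishes.
\<close>

lemma linearly_equivalent_obstructions:
  fixes A :: "'k::field"
  assumes two: "(2 :: 'k) \<noteq> 0"
    and equiv: "linearly_equivalent (quadratic_form A B C D E F) (quadratic_form A' B' C' D' E' F')"
  shows "A = 0 \<Longrightarrow> B = 0 \<Longrightarrow> C = 0 \<Longrightarrow> D = 0 \<Longrightarrow> E = 0 \<Longrightarrow> F = 0 \<Longrightarrow> F' = 0"
        "A = 0 \<Longrightarrow> B = 0 \<Longrightarrow> C = 0 \<Longrightarrow> D = 0 \<Longrightarrow> E = 0 \<Longrightarrow> D' = 0"
        "A = 0 \<Longrightarrow> B = 0 \<Longrightarrow> C = 0 \<Longrightarrow> A' = 0"
        "A = 1 \<Longrightarrow> B = 0 \<Longrightarrow> C = 0 \<Longrightarrow> D = 0 \<Longrightarrow> E = 0 \<Longrightarrow> B' * D' = 2 * A' * E'"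
        "A = 1 \<Longrightarrow> B = 0 \<Longrightarrow> C = 0 \<Longrightarrow> D = 0 \<Longrightarrow> E = 0 \<Longrightarrow> F = 0 \<Longrightarrow> D'\<^sup>2 = 4 * A' * F'"
        "A = 0 \<Longrightarrow> C = 0 \<Longrightarrow> D = 0 \<Longrightarrow> E = 0 \<Longrightarrow> F = 0 \<Longrightarrow>
        4 * A' * C' * F' + B' * D' * E' = A' * E'\<^sup>2 + C' * D'\<^sup>2 + F' * B'\<^sup>2"
proof -
  obtain a b c a' b' c' d \<delta> where \<delta>: "\<delta> \<noteq> 0" and
    eq: "\<delta> * A' = A * a\<^sup>2 + B * a * a' + C * a'\<^sup>2"
      "\<delta> * B' = 2 * A * a * b + B * (a * b' + b * a') + 2 * C * a' * b'"
      "\<delta> * C' = A * b\<^sup>2 + B * b * b' + C * b'\<^sup>2"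
      "\<delta> * D' = 2 * A * a * c + B * (a * c' + c * a') + 2 * C * a' * c' + (D * a + E * a') * d"
      "\<delta> * E' = 2 * A * b * c + B * (b * c' + c * b') + 2 * C * b' * c' + (D * b + E * b') * d"
      "\<delta> * F' = A * c\<^sup>2 + B * c * c' + C * c'\<^sup>2 + (D * c + E * c') * d + F * d\<^sup>2"
    by (rule linearly_equivalentE[OF two equiv]) metis
  show "A = 0 \<Longrightarrow> B = 0 \<Longrightarrow> C = 0 \<Longrightarrow> D = 0 \<Longrightarrow> E = 0 \<Longrightarrow> F = 0 \<Longrightarrow> F' = 0"
    using eq(6) \<delta> by simp
  show "A = 0 \<Longrightarrow> B = 0 \<Longrightarrow> C = 0 \<Longrightarrow> D = 0 \<Longrightarrow> E = 0 \<Longrightarrow> D' = 0"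
    using eq(4) \<delta> by simp
  show "A = 0 \<Longrightarrow> B = 0 \<Longrightarrow> C = 0 \<Longrightarrow> A' = 0"
    using eq(1) \<delta> by simp
  have "\<delta>\<^sup>2 * (B' * D' - 2 * A' * E') = (\<delta> * B') * (\<delta> * D') - 2 * (\<delta> * A') * (\<delta> * E')"
    by (simp add: power2_eq_square algebra_simps)
  then show "B' * D' = 2 * A' * E'" if "A = 1" "B = 0" "C = 0" "D = 0" "E = 0"
    using \<delta> unfolding eq that by (simp add: power2_eq_square algebra_simps)
  have "\<delta>\<^sup>2 * (D'\<^sup>2 - 4 * A' * F') = (\<delta> * D')\<^sup>2 - 4 * (\<delta> * A') * (\<delta> * F')"
    by (simp add: power2_eq_square algebra_simps)
  then show "D'\<^sup>2 = 4 * A' * F'" if "A = 1" "B = 0" "C = 0" "D = 0" "E = 0" "F = 0"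
    using \<delta> unfolding eq that by (simp add: power2_eq_square algebra_simps)
  have "\<delta>^3 * (4 * A' * C' * F' + B' * D' * E' - (A' * E'\<^sup>2 + C' * D'\<^sup>2 + F' * B'\<^sup>2)) =
      4 * (\<delta> * A') * (\<delta> * C') * (\<delta> * F') + (\<delta> * B') * (\<delta> * D') * (\<delta> * E')
      - ((\<delta> * A') * (\<delta> * E')\<^sup>2 + (\<delta> * C') * (\<delta> * D')\<^sup>2 + (\<delta> * F') * (\<delta> * B')\<^sup>2)"
    by (simp add: power2_eq_square power3_eq_cube algebra_simps)
  also have "\<dots> = 0" if "A = 0" "C = 0" "D = 0" "E = 0" "F = 0"
    unfolding eq that by (simp add: power2_eq_square algebra_simps)
  finally show "4 * A' * C' * F' + B' * D' * E' = A' * E'\<^sup>2 + C' * D'\<^sup>2 + F' * B'\<^sup>2"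
    if "A = 0" "C = 0" "D = 0" "E = 0" "F = 0"
    using that \<delta> by simp
qed

text \<open>
  Equivalence is assumed in both directions because an obstruction rules out only one direction
  between two normal forms. Where none applies and the forms may differ, equality of
  discriminants reads \<open>B\<^sup>2 = B'\<^sup>2\<close>.
\<close>

lemma linearly_equivalent_normal_forms:
  fixes g h :: "'k::alg_closed_field poly3"
  assumes two: "(2 :: 'k) \<noteq> 0"
    and "g \<in> normal_forms" "h \<in> normal_forms"
    and gh: "linearly_equivalent g h" and hg: "linearly_equivalent h g"
  shows "g = h \<or>
    (\<exists>lam. lam \<noteq> 0 \<and> g = smul lam (X * Y) \<and> h = smul (- lam) (X * Y)) \<or>
    (\<exists>lam. lam \<noteq> 0 \<and> g = smul lam (X * Y) + T\<^sup>2 \<and> h = smul (- lam) (X * Y) + T\<^sup>2)"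
proof -
  have "(4 :: 'k) = 2 * 2" by simp
  with two have four: "(4 :: 'k) \<noteq> 0" by (metis mult_eq_0_iff)
  obtain A B C D E F where g: "g = quadratic_form A B C D E F" and nf_g:
    "A = 0 \<and> B = 0 \<and> C = 0 \<and> D = 0 \<and> E = 0 \<and> F = 0 \<or>
      A = 0 \<and> B = 0 \<and> C = 0 \<and> D = 0 \<and> E = 0 \<and> F = 1 \<or>
      A = 0 \<and> B = 0 \<and> C = 0 \<and> D = 1 \<and> E = 0 \<and> F = 0 \<or>
      A = 1 \<and> B = 0 \<and> C = 0 \<and> D = 0 \<and> E = 0 \<and> F = 0 \<or>
      A = 1 \<and> B = 0 \<and> C = 0 \<and> D = 0 \<and> E = 0 \<and> F = 1 \<or>
      A = 1 \<and> B = 0 \<and> C = 0 \<and> D = 0 \<and> E = 1 \<and> F = 0 \<or>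
      A = 0 \<and> B \<noteq> 0 \<and> C = 0 \<and> D = 0 \<and> E = 0 \<and> F = 0 \<or>
      A = 0 \<and> B \<noteq> 0 \<and> C = 0 \<and> D = 0 \<and> E = 0 \<and> F = 1"
    by (cases rule: normal_forms_cases[OF assms(2)]) blast+
  obtain A' B' C' D' E' F' where h: "h = quadratic_form A' B' C' D' E' F'" and nf_h:
    "A' = 0 \<and> B' = 0 \<and> C' = 0 \<and> D' = 0 \<and> E' = 0 \<and> F' = 0 \<or>
      A' = 0 \<and> B' = 0 \<and> C' = 0 \<and> D' = 0 \<and> E' = 0 \<and> F' = 1 \<or>
      A' = 0 \<and> B' = 0 \<and> C' = 0 \<and> D' = 1 \<and> E' = 0 \<and> F' = 0 \<or>
      A' = 1 \<and> B' = 0 \<and> C' = 0 \<and> D' = 0 \<and> E' = 0 \<and> F' = 0 \<or>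
      A' = 1 \<and> B' = 0 \<and> C' = 0 \<and> D' = 0 \<and> E' = 0 \<and> F' = 1 \<or>
      A' = 1 \<and> B' = 0 \<and> C' = 0 \<and> D' = 0 \<and> E' = 1 \<and> F' = 0 \<or>
      A' = 0 \<and> B' \<noteq> 0 \<and> C' = 0 \<and> D' = 0 \<and> E' = 0 \<and> F' = 0 \<or>
      A' = 0 \<and> B' \<noteq> 0 \<and> C' = 0 \<and> D' = 0 \<and> E' = 0 \<and> F' = 1"
    by (cases rule: normal_forms_cases[OF assms(3)]) blast+
  note gh' = gh[unfolded g h] and hg' = hg[unfolded g h]
  have "(A = A' \<and> B = B' \<and> C = C' \<and> D = D' \<and> E = E' \<and> F = F') \<or>
      (A = 0 \<and> B \<noteq> 0 \<and> C = 0 \<and> D = 0 \<and> E = 0 \<and> (F = 0 \<or> F = 1) \<and>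
       A' = 0 \<and> B' = - B \<and> C' = 0 \<and> D' = 0 \<and> E' = 0 \<and> F' = F)"
    using nf_g nf_h discriminant_invariant[OF two gh'] linearly_equivalent_obstructions[OF two gh']
      linearly_equivalent_obstructions[OF two hg']
    by (elim disjE conjE)
       (simp_all add: two four two[symmetric] four[symmetric], auto simp: power2_eq_iff)
  then show ?thesis
    unfolding normal_forms_eq(8) unfolding normal_forms_eq(7) g h by auto
qed

text \<open>
  Swapping \<open>X\<close> and \<open>Y\<close> has determinant \<open>- 1\<close>, which changes the sign of \<open>\<lambda>\<close>; scaling \<open>T\<close> by a
  square root of \<open>- 1\<close> keeps \<open>T\<^sup>2\<close> in place.
\<close>

lemma linearly_equivalent_uminus_coefficient:
  fixes l :: "'k::alg_closed_field"
  shows "linearly_equivalent (smul l (X * Y)) (smul (- l) (X * Y))"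
    and "linearly_equivalent (smul l (X * Y) + T\<^sup>2) (smul (- l) (X * Y) + T\<^sup>2)"
proof -
  obtain s :: 'k where s: "s\<^sup>2 = - 1" using square_root_exists .
  then have "s \<noteq> 0" by auto
  with s show "linearly_equivalent (smul l (X * Y)) (smul (- l) (X * Y))"
    and "linearly_equivalent (smul l (X * Y) + T\<^sup>2) (smul (- l) (X * Y) + T\<^sup>2)"
    unfolding normal_forms_eq(8) unfolding normal_forms_eq(7)
    by (auto intro!: linearly_equivalentI[where a = 0 and b = 1 and a' = 1 and b' = 0 and c = 0
          and c' = 0 and d = s and \<delta> = "- 1"])
qed

lemma two_neq_zero:
  assumes "CHAR('k::field) \<noteq> 2"
  shows "(2 :: 'k) \<noteq> 0"
proof
  assume "(2 :: 'k) = 0"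
  then have "CHAR('k) dvd 2"
    by (metis of_nat_eq_0_iff_char_dvd of_nat_numeral)
  then have "CHAR('k) = 1 \<or> CHAR('k) = 2"
    using prime_nat_iff two_is_prime_nat by blast
  with assms show False by auto
qed

theorem theorem3p2:
  assumes "CHAR('k::alg_closed_field) \<noteq> 2"
  shows
    "(\<forall>(br :: 'k poly3 \<Rightarrow> 'k poly3 \<Rightarrow> 'k poly3) f.
        graded_bracket br \<and> f \<in> homogeneous 2 \<and> determined_by br f \<longrightarrow>
        (\<exists>g \<in> normal_forms. \<exists>br'. determined_by br' g \<and> poisson_isomorphic br br')) \<and>
     (\<forall>g \<in> (normal_forms :: 'k poly3 set). \<exists>!br. determined_by br g) \<and>
     (\<forall>g \<in> (normal_forms :: 'k poly3 set). \<forall>h \<in> normal_forms. \<forall>br br'.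
        determined_by br g \<and> determined_by br' h \<longrightarrow>
        (poisson_isomorphic br br' \<longleftrightarrow>
           g = h \<or>
           (\<exists>lam. lam \<noteq> 0 \<and> g = smul lam (X * Y) \<and> h = smul (- lam) (X * Y)) \<or>
           (\<exists>lam. lam \<noteq> 0 \<and> g = smul lam (X * Y) + T\<^sup>2 \<and> h = smul (- lam) (X * Y) + T\<^sup>2)))"
proof (intro conjI allI ballI impI)
  note two = two_neq_zero[OF assms]
  {
    fix br :: "'k poly3 \<Rightarrow> 'k poly3 \<Rightarrow> 'k poly3" and f
    assume "graded_bracket br \<and> f \<in> homogeneous 2 \<and> determined_by br f"
    then have br: "br = planar_bracket f" and "f \<in> homogeneous 2"
      using determined_by_unique by auto
    then obtain g where "g \<in> normal_forms" "linearly_equivalent g f"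
      using homogeneous_2_eq_quadratic_form linearly_equivalent_to_normal_form[OF two] by metis
    then show "\<exists>g \<in> normal_forms. \<exists>br'. determined_by br' g \<and> poisson_isomorphic br br'"
      unfolding br
      using determined_by_planar_bracket linearly_equivalent_imp_isomorphic poisson_isomorphic_sym
      by blast
  next
    fix g :: "'k poly3"
    show "\<exists>!br. determined_by br g"
      using determined_by_planar_bracket determined_by_unique by blast
  next
    fix g h :: "'k poly3" and br br'
    assume g: "g \<in> normal_forms" and h: "h \<in> normal_forms"
      and "determined_by br g \<and> determined_by br' h"
    then have br: "br = planar_bracket g" "br' = planar_bracket h"
      using determined_by_unique by auto
    have quadratic: "\<exists>A B C D E F. p = quadratic_form A B C D E F" if "p \<in> normal_forms" for p :: "'k poly3"
      by (cases rule: normal_forms_cases[OF that]) blast+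
    have equiv: "linearly_equivalent p q"
      if "poisson_isomorphic (planar_bracket p) (planar_bracket q)" "p \<in> normal_forms" "q \<in> normal_forms"
      for p q :: "'k poly3"
      using isomorphic_imp_linearly_equivalent[OF two _ _ that(1)] quadratic that(2,3) by metis
    show "poisson_isomorphic br br' \<longleftrightarrow> g = h \<or>
        (\<exists>lam. lam \<noteq> 0 \<and> g = smul lam (X * Y) \<and> h = smul (- lam) (X * Y)) \<or>
        (\<exists>lam. lam \<noteq> 0 \<and> g = smul lam (X * Y) + T\<^sup>2 \<and> h = smul (- lam) (X * Y) + T\<^sup>2)"
      (is "?iso \<longleftrightarrow> ?rel")
    proof
      assume ?iso
      then show ?rel
        unfolding br
        using linearly_equivalent_normal_forms[OF two g h] equiv g h poisson_isomorphic_sym by blast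
    next
      assume ?rel
      then show ?iso
        unfolding br
        using poisson_isomorphic_refl linearly_equivalent_imp_isomorphic
          linearly_equivalent_uminus_coefficient by metis
    qed
  }
qed

end
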